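(* Let $N\ge 2$, let $\mathcal H$ be an $N$-dimensional complex Hilbert space with fixed orthonormal basis $\{|\mu\rangle\}_{\mu=0}^{N-1}$, and let $\Lambda$ be an aQNN map, i.e. a completely positive trace-preserving map of the form $$\Lambda(\rho)=\sum_{\mu=0}^{N-1}\rho_{\mu\mu}|\mu\rangle\langle\mu|+\sum_{\mu<\nu}\Big[\rho_{\mu\nu}(1+\alpha_{\mu\nu})|\mu\rangle\langle\nu|+\mathrm{h.c.}\Big],\qquad \alpha_{\mu\nu}\in\mathbb C .$$ Then initial entanglement with an ancilla cannot be used to reduce the depth of the network, in the following sense: for every density operator $\rho$ on $\mathcal H$, every ancillary Hilbert space $\mathcal A$, every pure state $\psi=|\psi\rangle\langle\psi|$ on $\mathcal H\otimes\mathcal A$ with $\mathrm{Tr}_{\mathcal A}(\psi)=\rho$, and every coherence measure $C$, it is not the case that $$C(\Lambda(\rho))>C\big(\mathrm{Tr}_{\mathcal A}\{(\Lambda\otimes\mathrm{id})(\psi)\}\big).$$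
   Context: $\rho_{\mu\nu}=\langle\mu|\rho|\nu\rangle$, h.c. denotes the Hermitian conjugate, $\mathrm{id}$ is the identity map on $\mathcal B(\mathcal A)$, and $\mathrm{Tr}_{\mathcal A}$ is the partial trace over $\mathcal A$. A coherence measure is a functional $C:\mathcal B(\mathcal H)\to\mathbb R_{\ge0}$ with $C(\delta)=0$ for every incoherent state $\delta$ (density operator diagonal in the fixed basis) and $C(\rho)\ge C(\mathcal E(\rho))$ for every non-coherence-generating operation $\mathcal E$ (a channel mapping incoherent states to incoherent states). The depth of the network is the minimum number of applications of $\Lambda$ needed for the state's coherence to fall to a prescribed tolerance; using the entangled input would help reduce the depth precisely if it yielded an output with strictly smaller coherence than $\Lambda(\rho)$. *)

theory Defs
  imports "HOL-Analysis.Analysis"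
begin

text \<open>
  The space \<open>H\<close> is \<^typ>\<open>complex ^ 'n\<close>, so \<^term>\<open>CARD('n)\<close> is its dimension, and its fixed
  orthonormal basis is \<^term>\<open>axis \<mu> 1\<close>. Operators on \<open>H\<close> are matrices in that basis.
\<close>

type_synonym 'n ket = "complex ^ 'n"
type_synonym 'n oper = "complex ^ 'n ^ 'n"

definition cscale :: "complex \<Rightarrow> ('n::finite) oper \<Rightarrow> 'n oper"  (infixr "*\<^sub>C" 75)
  where "c *\<^sub>C A = (\<chi> i j. c * A $ i $ j)"

definition cdot :: "('n::finite) ket \<Rightarrow> 'n ket \<Rightarrow> complex"
  where "cdot u v = (\<Sum>i\<in>UNIV. cnj (u $ i) * v $ i)"

definition adj :: "('n::finite) oper \<Rightarrow> 'n oper"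
  where "adj A = (\<chi> i j. cnj (A $ j $ i))"

definition ketbra :: "('n::finite) ket \<Rightarrow> 'n ket \<Rightarrow> 'n oper"
  where "ketbra u v = (\<chi> i j. u $ i * cnj (v $ j))"

abbreviation basis_ketbra :: "'n \<Rightarrow> 'n \<Rightarrow> ('n::finite) oper"
  where "basis_ketbra \<mu> \<nu> \<equiv> ketbra (axis \<mu> 1) (axis \<nu> 1)"

text \<open>Over the complex numbers, nonnegativity of the quadratic form includes Hermiticity.\<close>

definition density_operator :: "('n::finite) oper \<Rightarrow> bool"
  where "density_operator \<rho> \<longleftrightarrow> (\<forall>v. cdot v (\<rho> *v v) \<in> \<real>\<^sub>\<ge>\<^sub>0) \<and> trace \<rho> = 1"

definition incoherent_state :: "('n::finite) oper \<Rightarrow> bool"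
  where "incoherent_state \<delta> \<longleftrightarrow> density_operator \<delta> \<and> (\<forall>\<mu> \<nu>. \<mu> \<noteq> \<nu> \<longrightarrow> \<delta> $ \<mu> $ \<nu> = 0)"

text \<open>
  An ancillary Hilbert space \<open>A\<close>, of finite or infinite dimension, is represented by the type
  \<open>'a\<close> indexing one of its orthonormal bases \<open>|a>\<close>, that is, as \<open>l\<^sup>2('a)\<close>; up to unitary
  equivalence this covers all Hilbert spaces other than zero. A vector of \<open>H \<otimes> A\<close> is a square-summable
  family \<open>\<psi>\<close>, standing for the sum of all \<open>\<psi> a \<otimes> |a>\<close>. An operator on \<open>H \<otimes> A\<close> is given by
  its blocks \<open>X a b\<close>, operators on \<open>H\<close>, standing for the sum of all \<open>X a b \<otimes> |a><b|\<close>.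
\<close>

type_synonym ('n, 'a) block_op = "'a \<Rightarrow> 'a \<Rightarrow> 'n oper"

definition unit_vector :: "('a \<Rightarrow> ('n::finite) ket) \<Rightarrow> bool"
  where "unit_vector \<psi> \<longleftrightarrow> ((\<lambda>a. (norm (\<psi> a))\<^sup>2) has_sum 1) UNIV"

definition pure_state :: "('a \<Rightarrow> ('n::finite) ket) \<Rightarrow> ('n, 'a) block_op"
  where "pure_state \<psi> = (\<lambda>a b. ketbra (\<psi> a) (\<psi> b))"

definition tensor_id ::
    "(('n::finite) oper \<Rightarrow> 'n oper) \<Rightarrow> ('n, 'a) block_op \<Rightarrow> ('n, 'a) block_op"
  where "tensor_id \<Lambda> X = (\<lambda>a b. \<Lambda> (X a b))"

definition partial_trace :: "('n, 'a) block_op \<Rightarrow> ('n::finite) oper"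
  where "partial_trace X = (\<Sum>\<^sub>\<infinity>a\<in>UNIV. X a a)"

text \<open>Positivity of the operator on \<open>H \<otimes> \<complex>\<^sup>k\<close> with blocks \<open>X a b\<close> for \<open>a, b < k\<close>.\<close>

definition block_positive :: "nat \<Rightarrow> ('n::finite, nat) block_op \<Rightarrow> bool"
  where "block_positive k X \<longleftrightarrow>
    (\<forall>v. (\<Sum>a<k. \<Sum>b<k. cdot (v a) (X a b *v v b)) \<in> \<real>\<^sub>\<ge>\<^sub>0)"

definition completely_positive :: "(('n::finite) oper \<Rightarrow> 'n oper) \<Rightarrow> bool"
  where "completely_positive \<Lambda> \<longleftrightarrow>
    Vector_Spaces.linear (*\<^sub>C) (*\<^sub>C) \<Lambda> \<and>
    (\<forall>k X. block_positive k X \<longrightarrow> block_positive k (tensor_id \<Lambda> X))"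

definition channel :: "(('n::finite) oper \<Rightarrow> 'n oper) \<Rightarrow> bool"
  where "channel \<Lambda> \<longleftrightarrow> completely_positive \<Lambda> \<and> (\<forall>X. trace (\<Lambda> X) = trace X)"

definition non_coherence_generating :: "(('n::finite) oper \<Rightarrow> 'n oper) \<Rightarrow> bool"
  where "non_coherence_generating \<E> \<longleftrightarrow>
    channel \<E> \<and> (\<forall>\<delta>. incoherent_state \<delta> \<longrightarrow> incoherent_state (\<E> \<delta>))"

definition coherence_measure :: "(('n::finite) oper \<Rightarrow> real) \<Rightarrow> bool"
  where "coherence_measure C \<longleftrightarrow>
    (\<forall>X. C X \<ge> 0) \<and>
    (\<forall>\<delta>. incoherent_state \<delta> \<longrightarrow> C \<delta> = 0) \<and>
    (\<forall>\<E> \<rho>. non_coherence_generating \<E> \<longrightarrow> density_operator \<rho> \<longrightarrow> C \<rho> \<ge> C (\<E> \<rho>))"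

text \<open>
  The formula is required on density operators only, which determine a linear map. It must not be
  imposed on all operators: taking the Hermitian conjugate is antilinear, so the right-hand side is
  complex linear in \<open>\<rho>\<close> only as the extension from Hermitian arguments.
\<close>

definition aQNN_map :: "(('n::{finite,linorder}) oper \<Rightarrow> 'n oper) \<Rightarrow> bool"
  where "aQNN_map \<Lambda> \<longleftrightarrow> channel \<Lambda> \<and>
    (\<exists>\<alpha> :: 'n \<Rightarrow> 'n \<Rightarrow> complex. \<forall>\<rho>. density_operator \<rho> \<longrightarrow>
      \<Lambda> \<rho> = (\<Sum>\<mu>\<in>UNIV. \<rho> $ \<mu> $ \<mu> *\<^sub>C basis_ketbra \<mu> \<mu>)
        + (\<Sum>(\<mu>, \<nu>) | \<mu> < \<nu>.
            (\<rho> $ \<mu> $ \<nu> * (1 + \<alpha> \<mu> \<nu>)) *\<^sub>C basis_ketbra \<mu> \<nu>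
            + adj ((\<rho> $ \<mu> $ \<nu> * (1 + \<alpha> \<mu> \<nu>)) *\<^sub>C basis_ketbra \<mu> \<nu>)))"

end

theory Submission
  imports Defs
begin

text \<open>
  The map \<open>\<Lambda> \<otimes> id\<close> commutes with the partial trace over the ancilla, because \<open>\<Lambda>\<close> is linear and hence
  continuous in finite dimension. So the two outputs coincide, whatever the entanglement of the input.
\<close>

lemma scaleR_eq_cscale: "r *\<^sub>R (A :: ('n::finite) oper) = complex_of_real r *\<^sub>C A"
  unfolding cscale_def by (simp add: vec_eq_iff scaleR_conv_of_real[where 'a = complex])

text \<open>\<open>bounded_linear\<close> is a notion over the reals, so complex homogeneity is
  restricted to real scalars first.\<close>

lemma cscale_linear_imp_bounded_linear:
  fixes \<Lambda> :: "('n::finite) oper \<Rightarrow> 'n oper"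
  assumes "Vector_Spaces.linear (*\<^sub>C) (*\<^sub>C) \<Lambda>"
  shows "bounded_linear \<Lambda>"
proof -
  interpret Vector_Spaces.linear "(*\<^sub>C)" "(*\<^sub>C)" \<Lambda> by fact
  have "linear \<Lambda>"
    by (rule linearI) (simp_all only: add scale scaleR_eq_cscale)
  then show ?thesis
    by (simp only: linear_conv_bounded_linear)
qed

text \<open>Summability matters: \<Lambda> could annihilate a divergent part, leaving a nonzero sum
  on the left and, by the default value, \<open>\<Lambda> 0 = 0\<close> on the right.\<close>

lemma partial_trace_tensor_id:
  fixes \<Lambda> :: "('n::finite) oper \<Rightarrow> 'n oper"
  assumes "bounded_linear \<Lambda>" and "(\<lambda>a. X a a) summable_on UNIV"
  shows "partial_trace (tensor_id \<Lambda> X) = \<Lambda> (partial_trace X)"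
  unfolding partial_trace_def tensor_id_def
  by (intro infsumI has_sum_bounded_linear[OF assms(1)] has_sum_infsum assms(2))

theorem proposition7:
  fixes \<Lambda> :: "('n::{finite,linorder}) oper \<Rightarrow> 'n oper"
    and \<rho> :: "'n oper"
    and \<psi> :: "'a \<Rightarrow> 'n ket"
    and C :: "'n oper \<Rightarrow> real"
  assumes "CARD('n) \<ge> 2"
    and "aQNN_map \<Lambda>"
    and "density_operator \<rho>"
    and "unit_vector \<psi>"
    and "partial_trace (pure_state \<psi>) = \<rho>"
    and "coherence_measure C"
  shows "\<not> C (\<Lambda> \<rho>) > C (partial_trace (tensor_id \<Lambda> (pure_state \<psi>)))"
proof -
  have bl: "bounded_linear \<Lambda>"
    using assms(2) unfolding aQNN_map_def channel_def completely_positive_def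
    by (blast intro: cscale_linear_imp_bounded_linear)
  \<comment> \<open>The zero operator has trace 0, not 1.\<close>
  have "\<rho> \<noteq> 0"
    using assms(3) unfolding density_operator_def by (auto simp: trace_def)
  \<comment> \<open>A divergent partial trace has the junk value \<open>0\<close>, which is not a density operator.\<close>
  then have "(\<lambda>a. pure_state \<psi> a a) summable_on UNIV"
    using assms(5) unfolding partial_trace_def by (metis infsum_not_exists)
  then have "partial_trace (tensor_id \<Lambda> (pure_state \<psi>)) = \<Lambda> \<rho>"
    using partial_trace_tensor_id[OF bl] assms(5) by blast
  \<comment> \<open>\<open>C\<close> is evaluated at the same operator on both sides.\<close>
  then show ?thesis by simp
qed

end
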